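(* Let $L(\lambda)=\lambda M+K\in\mathbb{C}^{n\times n}[\lambda]$ with $M^*=-M$ and $K$ Hermitian positive definite. Let $x_1^c,\dots,x_p^c,x_{p+1}^f,\dots,x_n^f$ be a basis of $\mathbb{C}^n$ of eigenvectors of $L(\lambda)$ with $L(\lambda_i^c)x_i^c=0$ $(1\le i\le p)$ and $L(\lambda_j^f)x_j^f=0$ $(p+1\le j\le n)$, where $\lambda_i^c\ne0$, $(x_i^c)^*Kx_j^c=0$ for $i\ne j$ and $(x_i^c)^*Kx_i^c=1$. Set $X_c=[x_1^c\ \cdots\ x_p^c]$, $X_f=[x_{p+1}^f\ \cdots\ x_n^f]$, $\Lambda_c=\mathrm{diag}(\lambda_i^c)$, $\Lambda_f=\mathrm{diag}(\lambda_j^f)$. Suppose $\{\lambda_1^c,\dots,\lambda_p^c\}\cap\{\lambda_{p+1}^f,\dots,\lambda_n^f\}=\emptyset$ and let $\Lambda_a\in\mathbb{C}^{p\times p}$ be a diagonal matrix with purely imaginary diagonal entries. Let $Z_1$ be an arbitrary diagonal $p\times p$ matrix with purely imaginary diagonal entries and $Z_2$ an arbitrary real diagonal $p\times p$ matrix. Put $H_a=(I_p-\Lambda_a^2)^{-1}$ and $$\hat M=H_a\left[\Lambda_c^{-1}(\Lambda_c-\Lambda_a)\Lambda_a+Z_1+Z_2\Lambda_a\right],\qquad \hat K=H_a\left[\Lambda_c^{-1}(\Lambda_a-\Lambda_c)-Z_1\Lambda_a-Z_2\Lambda_a^2\right],$$ $$\Delta M=KX_c\hat MX_c^*K,\qquad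 \Delta K=KX_c\hat KX_c^*K.$$ Then $(\Delta M)^*=-\Delta M$, $(\Delta K)^*=\Delta K$, and $(X_c,\Lambda_a)$ and $(X_f,\Lambda_f)$ are complementary deflating pairs of $L_\Delta(\lambda)=\lambda(M+\Delta M)+(K+\Delta K)$. Moreover, if $Z_1$ and $Z_2$ are chosen such that $\Lambda_c^{-1}(\Lambda_a-\Lambda_c)-Z_1\Lambda_a-Z_2\Lambda_a^2$ is a diagonal matrix with non-negative diagonal entries, then $\Delta K$ is positive semi-definite, and hence $K+\Delta K$ is positive definite.
   Context: A deflating pair of a pencil $\lambda M+K\in\mathbb{C}^{n\times n}[\lambda]$ is a matrix pair $(X,\Lambda)\in\mathbb{C}^{n\times p}\times\mathbb{C}^{p\times p}$ with $\operatorname{rank}X=p\le n$ and $MX\Lambda+KX=0$. Two deflating pairs $(X_1,\Lambda_1)$, $(X_2,\Lambda_2)$ are complementary if $[X_1\ X_2]$ is a nonsingular square matrix. $A^*$ is the conjugate transpose of $A$. Zero is allowed as a purely imaginary number. *)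

theory Defs
  imports
    "Jordan_Normal_Form.DL_Rank"
    "Jordan_Normal_Form.Schur_Decomposition"
    "Jordan_Normal_Form.Gauss_Jordan_Elimination"
begin

text \<open>Only meaningful for invertible \<open>A\<close>; otherwise the value is unspecified.\<close>

definition mat_inv :: "complex mat \<Rightarrow> complex mat" where
  "mat_inv A = the (mat_inverse A)"

definition hermitian_mat :: "complex mat \<Rightarrow> bool" where
  "hermitian_mat A \<longleftrightarrow> mat_adjoint A = A"

text \<open>
  The product \<open>(A *\<^sub>v v) \<bullet>c v\<close> is \<open>v\<^sup>* A v\<close>, as \<open>\<bullet>c\<close> conjugates its second argument.
  In the order on the complex numbers used here, \<open>0 \<le> z\<close> and \<open>0 < z\<close> include that \<open>z\<close> is real.
\<close>

definition positive_definite :: "nat \<Rightarrow> complex mat \<Rightarrow> bool" where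
  "positive_definite n A \<longleftrightarrow> A \<in> carrier_mat n n \<and> hermitian_mat A \<and>
     (\<forall>v \<in> carrier_vec n. v \<noteq> 0\<^sub>v n \<longrightarrow> 0 < (A *\<^sub>v v) \<bullet>c v)"

definition positive_semidefinite :: "nat \<Rightarrow> complex mat \<Rightarrow> bool" where
  "positive_semidefinite n A \<longleftrightarrow> A \<in> carrier_mat n n \<and> hermitian_mat A \<and>
     (\<forall>v \<in> carrier_vec n. 0 \<le> (A *\<^sub>v v) \<bullet>c v)"

definition pencil :: "complex mat \<Rightarrow> complex mat \<Rightarrow> complex \<Rightarrow> complex mat" where
  "pencil M K l = l \<cdot>\<^sub>m M + K"

definition pencil_eigenvector ::
    "nat \<Rightarrow> complex mat \<Rightarrow> complex mat \<Rightarrow> complex \<Rightarrow> complex vec \<Rightarrow> bool" where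
  "pencil_eigenvector n M K l x \<longleftrightarrow>
     x \<in> carrier_vec n \<and> x \<noteq> 0\<^sub>v n \<and> pencil M K l *\<^sub>v x = 0\<^sub>v n"

definition basis_list :: "nat \<Rightarrow> complex vec list \<Rightarrow> bool" where
  "basis_list n vs \<longleftrightarrow>
     distinct vs \<and> vectorspace.basis class_ring (module_vec TYPE(complex) n) (set vs)"

text \<open>The pencil \<open>\<lambda> M + K\<close> is represented by its coefficients \<open>M\<close> and \<open>K\<close>.\<close>

definition deflating_pair ::
    "nat \<Rightarrow> nat \<Rightarrow> complex mat \<Rightarrow> complex mat \<Rightarrow> complex mat \<times> complex mat \<Rightarrow> bool" where
  "deflating_pair n p M K P \<longleftrightarrow> (case P of (X, L) \<Rightarrow>
     X \<in> carrier_mat n p \<and> L \<in> carrier_mat p p \<and>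
     vec_space.rank n X = p \<and> p \<le> n \<and>
     M * X * L + K * X = 0\<^sub>m n p)"

definition complementary_deflating_pairs ::
    "nat \<Rightarrow> complex mat \<Rightarrow> complex mat \<Rightarrow>
     complex mat \<times> complex mat \<Rightarrow> complex mat \<times> complex mat \<Rightarrow> bool" where
  "complementary_deflating_pairs n M K P Q \<longleftrightarrow>
     deflating_pair n (dim_col (fst P)) M K P \<and>
     deflating_pair n (dim_col (fst Q)) M K Q \<and>
     invertible_mat (mat_of_cols n (cols (fst P) @ cols (fst Q)))"

end

theory Submission
  imports Defs
begin

text \<open>
  Put \<open>B = K X\<^sub>c\<close>. Both updates are congruences \<open>B D B\<^sup>*\<close> of a diagonal matrix \<open>D\<close>, so their
  symmetry and definiteness can be read off the entries of \<open>D\<close>, and their action on the basis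
  of eigenvectors is explicit once the vectors \<open>B\<^sup>* x\<close> are known. For \<open>x = x\<^sub>j\<^sup>c\<close> this is the \<open>j\<close>-th
  unit vector, because \<open>X\<^sub>c\<close> is \<open>K\<close>-orthonormal. For \<open>x = x\<^sub>j\<^sup>f\<close> it vanishes: the eigenvalues of the
  pencil are imaginary (lemma \<open>eigenvalue_imaginary\<close>), and eigenvectors for different
  eigenvalues are \<open>K\<close>-orthogonal (lemma \<open>eigenvectors_orthogonal\<close>). The updates therefore
  annihilate \<open>X\<^sub>f\<close>, whose eigenvalues stay in place, and act on \<open>x\<^sub>j\<^sup>c\<close> as multiples of \<open>K x\<^sub>j\<^sup>c\<close>.

  Since \<open>c M x = - K x\<close> for an eigenvector \<open>x\<close> in \<open>X\<^sub>c\<close> with eigenvalue \<open>c\<close>, the updated pencil at \<open>a\<close>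
  maps \<open>x\<close> to \<open>(- a / c + a m + 1 + k) K x\<close>, where \<open>m\<close> and \<open>k\<close> are the diagonal entries of the two
  updates. Everything thus reduces to the scalar identity \<open>a m + 1 + k = a / c\<close> of lemma
  \<open>update_moves_eigenvalue\<close>. Symmetry and definiteness of the updates follow from the entries:
  with \<open>a\<close> and \<open>c\<close> imaginary, \<open>m\<close> is imaginary and \<open>k\<close> is real, and \<open>1 / (1 - a\<^sup>2)\<close> is a positive
  real number, so that \<open>k\<close> is non-negative when its other factor is. Ranks and complementarity
  come from the basis property alone.
\<close>

section \<open>Adjoints and diagonal matrices\<close>

lemma mat_adjoint_index:
  "i < dim_col A \<Longrightarrow> j < dim_row A \<Longrightarrow> mat_adjoint A $$ (i, j) = conjugate (A $$ (j, i))"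
  unfolding mat_adjoint_def by (simp add: mat_of_rows_index)

lemma dim_mat_adjoint [simp]:
  "dim_row (mat_adjoint A) = dim_col A" "dim_col (mat_adjoint A) = dim_row A"
  unfolding mat_adjoint_def by auto

lemma mat_adjoint_carrier [simp]:
  "A \<in> carrier_mat n m \<Longrightarrow> mat_adjoint A \<in> carrier_mat m n"
  by auto

lemma mat_adjoint_adjoint [simp]:
  fixes A :: "complex mat"
  shows "mat_adjoint (mat_adjoint A) = A"
  by (rule eq_matI) (auto simp: mat_adjoint_index)

lemma mat_adjoint_mult:
  fixes A B :: "complex mat"
  assumes "A \<in> carrier_mat n m" "B \<in> carrier_mat m k"
  shows "mat_adjoint (A * B) = mat_adjoint B * mat_adjoint A"
  using assms
  by (intro eq_matI) (auto simp: mat_adjoint_index scalar_prod_def sum_conjugate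
      conjugate_dist_mul mult.commute intro!: sum.cong)

lemma mat_adjoint_add:
  fixes A B :: "complex mat"
  assumes "A \<in> carrier_mat n m" "B \<in> carrier_mat n m"
  shows "mat_adjoint (A + B) = mat_adjoint A + mat_adjoint B"
  using assms by (intro eq_matI) (auto simp: mat_adjoint_index conjugate_dist_add)

lemma mat_adjoint_mat_diag:
  "mat_adjoint (mat_diag p d) = mat_diag p (\<lambda>i. cnj (d i))"
  by (rule eq_matI) (auto simp: mat_adjoint_index mat_diag_def)

lemma cscalar_prod_adjoint:
  fixes A :: "complex mat"
  assumes A: "A \<in> carrier_mat n m" and v: "v \<in> carrier_vec m" and w: "w \<in> carrier_vec n"
  shows "(A *\<^sub>v v) \<bullet>c w = v \<bullet>c (mat_adjoint A *\<^sub>v w)"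
proof -
  have "(A *\<^sub>v v) \<bullet>c w = (\<Sum>i<n. \<Sum>j<m. A $$ (i, j) * v $ j * cnj (w $ i))"
    using A v w by (simp add: scalar_prod_def sum_distrib_right atLeast0LessThan)
  also have "\<dots> = (\<Sum>j<m. \<Sum>i<n. A $$ (i, j) * v $ j * cnj (w $ i))"
    by (rule sum.swap)
  also have "\<dots> = v \<bullet>c (mat_adjoint A *\<^sub>v w)"
    using A v w
    by (simp add: scalar_prod_def sum_distrib_left atLeast0LessThan mat_adjoint_index algebra_simps)
  finally show ?thesis .
qed

lemma cscalar_prod_swap:
  fixes v w :: "complex vec"
  assumes "v \<in> carrier_vec n" "w \<in> carrier_vec n"
  shows "w \<bullet>c v = cnj (v \<bullet>c w)"
  using assms by (simp add: scalar_prod_def mult.commute)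

lemma mat_diag_add:
  fixes d e :: "nat \<Rightarrow> complex"
  shows "mat_diag p d + mat_diag p e = mat_diag p (\<lambda>i. d i + e i)"
  by (rule eq_matI) (auto simp: mat_diag_def)

lemma mat_diag_diff:
  fixes d e :: "nat \<Rightarrow> complex"
  shows "mat_diag p d - mat_diag p e = mat_diag p (\<lambda>i. d i - e i)"
  by (rule eq_matI) (auto simp: mat_diag_def)

lemma mat_diag_cong:
  "(\<And>i. i < p \<Longrightarrow> d i = e i) \<Longrightarrow> mat_diag p d = mat_diag p e"
  by (rule eq_matI) (auto simp: mat_diag_def)

lemma diagonal_mat_eq_mat_diag:
  "A \<in> carrier_mat p p \<Longrightarrow> diagonal_mat A \<Longrightarrow> A = mat_diag p (\<lambda>i. A $$ (i, i))"
  by (rule eq_matI) (auto simp: mat_diag_def diagonal_mat_def)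

lemma mat_diag_mult_vec_index:
  fixes d :: "nat \<Rightarrow> complex"
  assumes "v \<in> carrier_vec p" "i < p"
  shows "(mat_diag p d *\<^sub>v v) $ i = d i * v $ i"
proof -
  have "(mat_diag p d *\<^sub>v v) $ i = (\<Sum>j\<in>{0..<p}. (if i = j then d j else 0) * v $ j)"
    using assms by (simp add: scalar_prod_def mat_diag_def)
  also have "\<dots> = (\<Sum>j\<in>{0..<p}. if j = i then d i * v $ i else 0)"
    by (rule sum.cong) auto
  finally have "(mat_diag p d *\<^sub>v v) $ i = (\<Sum>j\<in>{0..<p}. if j = i then d i * v $ i else 0)" .
  then show ?thesis using assms by simp
qed

lemma mat_inv_mat_diag:
  assumes nz: "\<And>i. i < p \<Longrightarrow> d i \<noteq> 0"
  shows "mat_inv (mat_diag p d) = mat_diag p (\<lambda>i. 1 / d i)"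
proof -
  let ?D = "mat_diag p d" and ?E = "mat_diag p (\<lambda>i. 1 / d i)"
  have D: "?D \<in> carrier_mat p p" and E: "?E \<in> carrier_mat p p" by auto
  have "mat_diag p (\<lambda>i. d i * (1 / d i)) = mat_diag p (\<lambda>i. 1)"
    "mat_diag p (\<lambda>i. 1 / d i * d i) = mat_diag p (\<lambda>i. 1)"
    by (rule mat_diag_cong, simp add: nz)+
  then have DE: "?D * ?E = 1\<^sub>m p" and ED: "?E * ?D = 1\<^sub>m p"
    by (simp_all only: mat_diag_diag mat_diag_one)
  then have "?D \<in> Units (ring_mat TYPE(complex) p ())"
    unfolding Units_def ring_mat_simps using D E by blast
  then obtain B where B: "mat_inverse ?D = Some B"
    using mat_inverse(1)[OF D, where b = "()"] by (cases "mat_inverse ?D") auto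
  have B': "B * ?D = 1\<^sub>m p" "B \<in> carrier_mat p p"
    using mat_inverse(2)[OF D B] by auto
  have "B = B * (?D * ?E)" unfolding DE by (rule right_mult_one_mat[OF B'(2), symmetric])
  also have "\<dots> = ?E"
    unfolding assoc_mult_mat[OF B'(2) D E, symmetric] B'(1) by (rule left_mult_one_mat[OF E])
  finally show ?thesis unfolding mat_inv_def B by simp
qed

section \<open>Bases and deflating pairs\<close>

lemma basis_list_rank:
  assumes "basis_list n vs" "distinct us" "set us \<subseteq> set vs"
  shows "vec_space.rank n (mat_of_cols n us) = length us"
proof -
  interpret V: vec_space "TYPE(complex)" n .
  have b: "V.basis (set vs)" using assms(1) unfolding basis_list_def by simp
  then have li: "V.lin_indpt (set vs)" and car: "set vs \<subseteq> carrier_vec n"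
    unfolding V.basis_def by auto
  have us: "set us \<subseteq> carrier_vec n" using car assms(3) by blast
  have "V.lin_indpt (set us)"
    using li assms(3) V.subset_li_is_li by blast
  then show ?thesis using assms(2) us
    by (intro V.lin_indpt_full_rank) auto
qed

lemma basis_list_invertible:
  assumes b: "basis_list n vs" and len: "length vs = n"
  shows "invertible_mat (mat_of_cols n vs)"
proof -
  interpret V: vec_space "TYPE(complex)" n .
  let ?A = "mat_of_cols n vs"
  have A: "?A \<in> carrier_mat n n" using mat_of_cols_carrier(1)[of n vs] len by simp
  have "V.rank ?A = n"
    using basis_list_rank[OF b _ subset_refl] b len unfolding basis_list_def by simp
  then have "det ?A \<noteq> 0" using V.det_rank_iff[OF A] by simp
  from det_non_zero_imp_unit[OF A this, of "()"]
  obtain B where "B \<in> carrier_mat n n" "?A * B = 1\<^sub>m n" "B * ?A = 1\<^sub>m n"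
    unfolding Units_def ring_mat_simps by auto
  then show ?thesis using A unfolding invertible_mat_def inverts_mat_def by auto
qed

lemma pencil_mult_vec:
  assumes "A \<in> carrier_mat n n" "B \<in> carrier_mat n n" "v \<in> carrier_vec n"
  shows "pencil A B l *\<^sub>v v = l \<cdot>\<^sub>v (A *\<^sub>v v) + B *\<^sub>v v"
  unfolding pencil_def using assms
  by (subst add_mult_distrib_mat_vec[of _ n n]) auto

text \<open>For a diagonal \<open>L\<close> the defining equation of a deflating pair separates into the columns:
  it asks each column to be annihilated by the pencil at the matching diagonal entry.\<close>

lemma deflating_pair_diagI:
  assumes A: "A \<in> carrier_mat n n" and B: "B \<in> carrier_mat n n"
    and x: "\<And>j. j < q \<Longrightarrow> x j \<in> carrier_vec n"
    and rank: "vec_space.rank n (mat_of_cols n (map x [0..<q])) = q" and q: "q \<le> n"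
    and ev: "\<And>j. j < q \<Longrightarrow> pencil A B (l j) *\<^sub>v x j = 0\<^sub>v n"
  shows "deflating_pair n q A B (mat_of_cols n (map x [0..<q]), mat_diag q l)"
proof -
  let ?X = "mat_of_cols n (map x [0..<q])" and ?L = "mat_diag q l"
  have X: "?X \<in> carrier_mat n q" using mat_of_cols_carrier(1)[of n "map x [0..<q]"] by simp
  have AX: "A * ?X \<in> carrier_mat n q" and BX: "B * ?X \<in> carrier_mat n q"
    using A B X by (auto simp del: mat_of_cols_map)
  have colX: "col ?X j = x j" if "j < q" for j
    using that x by (subst col_mat_of_cols) auto
  have "A * ?X * ?L + B * ?X = 0\<^sub>m n q"
  proof (rule eq_matI)
    fix i j assume "i < dim_row (0\<^sub>m n q :: complex mat)" "j < dim_col (0\<^sub>m n q :: complex mat)"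
    then have ij: "i < n" "j < q" by auto
    have entry: "(C * ?X) $$ (i, j) = (C *\<^sub>v x j) $ i" if "C \<in> carrier_mat n n" for C
      using that ij colX by (simp del: mat_of_cols_map)
    have "(A * ?X * ?L + B * ?X) $$ (i, j) = (A * ?X) $$ (i, j) * l j + (B * ?X) $$ (i, j)"
      using ij A B AX BX by (simp add: mat_diag_mult_right[OF AX] del: index_mult_mat(1))
    also have "\<dots> = (pencil A B (l j) *\<^sub>v x j) $ i"
      unfolding entry[OF A] entry[OF B] pencil_mult_vec[OF A B x[OF ij(2)]]
      using ij A B x[OF ij(2)] by (simp add: mult.commute)
    finally show "(A * ?X * ?L + B * ?X) $$ (i, j) = 0\<^sub>m n q $$ (i, j)"
      using ev[OF ij(2)] ij by simp
  qed (use A B in auto)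
  then show ?thesis unfolding deflating_pair_def using X rank q by simp
qed

section \<open>Spectral structure of a pencil with skew-Hermitian and positive definite coefficients\<close>

text \<open>The value \<open>y\<^sup>* K x\<close> can be computed from either eigenvector. The equation for \<open>x\<close> gives the
  factor \<open>- l\<close>. The equation for \<open>y\<close>, conjugated, gives \<open>cnj m\<close> with the opposite sign, because
  \<open>K\<close> is Hermitian and \<open>M\<close> skew-Hermitian. Comparing the two yields both that eigenvalues are
  imaginary (\<open>y = x\<close>) and that eigenvectors are orthogonal (\<open>l \<noteq> m\<close>).\<close>

lemma eigen_forms:
  assumes M: "M \<in> carrier_mat n n" "mat_adjoint M = - M"
    and K: "K \<in> carrier_mat n n" "mat_adjoint K = K"
    and x: "pencil_eigenvector n M K l x" and y: "pencil_eigenvector n M K m y"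
  shows "(K *\<^sub>v x) \<bullet>c y = - l * ((M *\<^sub>v x) \<bullet>c y)"
    and "(K *\<^sub>v x) \<bullet>c y = cnj m * ((M *\<^sub>v x) \<bullet>c y)"
proof -
  have left: "(K *\<^sub>v u) \<bullet>c w = - c * ((M *\<^sub>v u) \<bullet>c w)"
    if u: "pencil_eigenvector n M K c u" and w: "w \<in> carrier_vec n" for c u w
  proof -
    have uc: "u \<in> carrier_vec n" using u unfolding pencil_eigenvector_def by simp
    have "c \<cdot>\<^sub>v (M *\<^sub>v u) + K *\<^sub>v u = 0\<^sub>v n"
      using u pencil_mult_vec[OF M(1) K(1) uc] unfolding pencil_eigenvector_def by simp
    then have "(c \<cdot>\<^sub>v (M *\<^sub>v u) + K *\<^sub>v u) \<bullet>c w = 0" using w by simp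
    then have "c * ((M *\<^sub>v u) \<bullet>c w) + (K *\<^sub>v u) \<bullet>c w = 0"
      using M(1) K(1) uc w
      by (subst (asm) add_scalar_prod_distrib[of _ n]) auto
    then show ?thesis by (simp add: add_eq_0_iff)
  qed
  have xc: "x \<in> carrier_vec n" and yc: "y \<in> carrier_vec n"
    using x y unfolding pencil_eigenvector_def by auto
  show "(K *\<^sub>v x) \<bullet>c y = - l * ((M *\<^sub>v x) \<bullet>c y)" by (rule left[OF x yc])
  have "(M *\<^sub>v x) \<bullet>c y = x \<bullet>c (- (M *\<^sub>v y))"
    using cscalar_prod_adjoint[OF M(1) xc yc] M yc by simp
  also have "\<dots> = - cnj ((M *\<^sub>v y) \<bullet>c x)"
    using M(1) xc yc by (simp add: cscalar_prod_swap[of x n] scalar_prod_def sum_negf mult.commute)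
  finally have Mxy: "(M *\<^sub>v x) \<bullet>c y = - cnj ((M *\<^sub>v y) \<bullet>c x)" .
  have "(K *\<^sub>v x) \<bullet>c y = cnj ((K *\<^sub>v y) \<bullet>c x)"
    using cscalar_prod_adjoint[OF K(1) xc yc] K xc yc
    by (simp add: cscalar_prod_swap[of "K *\<^sub>v y" n x])
  also have "\<dots> = cnj m * ((M *\<^sub>v x) \<bullet>c y)"
    unfolding left[OF y xc] Mxy by simp
  finally show "(K *\<^sub>v x) \<bullet>c y = cnj m * ((M *\<^sub>v x) \<bullet>c y)" .
qed

lemma eigenvalue_imaginary:
  assumes "M \<in> carrier_mat n n" "mat_adjoint M = - M"
    and K: "positive_definite n K" and x: "pencil_eigenvector n M K l x"
  shows "cnj l = - l"
proof -
  have K': "K \<in> carrier_mat n n" "mat_adjoint K = K"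
    using K unfolding positive_definite_def hermitian_mat_def by auto
  have "0 < (K *\<^sub>v x) \<bullet>c x"
    using K x unfolding positive_definite_def pencil_eigenvector_def by blast
  then have nz: "(K *\<^sub>v x) \<bullet>c x \<noteq> 0" by force
  have "- l * ((M *\<^sub>v x) \<bullet>c x) = cnj l * ((M *\<^sub>v x) \<bullet>c x)"
    using eigen_forms[OF assms(1,2) K' x x] by simp
  moreover have "(M *\<^sub>v x) \<bullet>c x \<noteq> 0"
    using eigen_forms(1)[OF assms(1,2) K' x x] nz by force
  ultimately show ?thesis by (metis mult_right_cancel)
qed

lemma eigenvectors_orthogonal:
  assumes "M \<in> carrier_mat n n" "mat_adjoint M = - M"
    and K: "positive_definite n K"
    and x: "pencil_eigenvector n M K l x" and y: "pencil_eigenvector n M K m y"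
    and "l \<noteq> m"
  shows "(K *\<^sub>v x) \<bullet>c y = 0"
proof -
  have K': "K \<in> carrier_mat n n" "mat_adjoint K = K"
    using K unfolding positive_definite_def hermitian_mat_def by auto
  have "- l * ((M *\<^sub>v x) \<bullet>c y) = - m * ((M *\<^sub>v x) \<bullet>c y)"
    using eigen_forms[OF assms(1,2) K' x y] eigenvalue_imaginary[OF assms(1,2) K y] by metis
  then have "(M *\<^sub>v x) \<bullet>c y = 0" using \<open>l \<noteq> m\<close> by auto
  then show ?thesis using eigen_forms(1)[OF assms(1,2) K' x y] by simp
qed

section \<open>Congruences of diagonal matrices\<close>

definition diag_congruence :: "complex mat \<Rightarrow> (nat \<Rightarrow> complex) \<Rightarrow> complex mat" where
  "diag_congruence B d = B * mat_diag (dim_col B) d * mat_adjoint B"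

lemma diag_congruence_carrier:
  "B \<in> carrier_mat n p \<Longrightarrow> diag_congruence B d \<in> carrier_mat n n"
  unfolding diag_congruence_def by (auto simp: mat_diag_def)

lemma diag_congruence_adjoint:
  assumes B: "B \<in> carrier_mat n p"
  shows "mat_adjoint (diag_congruence B d) = diag_congruence B (\<lambda>i. cnj (d i))"
proof -
  have D: "mat_diag p e \<in> carrier_mat p p" for e :: "nat \<Rightarrow> complex" by simp
  have "mat_adjoint (B * mat_diag p d * mat_adjoint B) =
      B * (mat_diag p (\<lambda>i. cnj (d i)) * mat_adjoint B)"
    using B D by (subst mat_adjoint_mult[of _ n p])
      (auto simp: mat_adjoint_mult[OF B D] mat_adjoint_mat_diag)
  then show ?thesis unfolding diag_congruence_def using B D
    by (simp add: assoc_mult_mat[OF B D, of "mat_adjoint B" n])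
qed

lemma diag_congruence_hermitian:
  assumes B: "B \<in> carrier_mat n p" and d: "\<And>i. i < p \<Longrightarrow> cnj (d i) = d i"
  shows "mat_adjoint (diag_congruence B d) = diag_congruence B d"
proof -
  have "mat_diag p (\<lambda>i. cnj (d i)) = mat_diag p d" using d by (rule mat_diag_cong)
  then show ?thesis unfolding diag_congruence_adjoint[OF B] using B
    by (simp add: diag_congruence_def)
qed

lemma diag_congruence_skew:
  assumes B: "B \<in> carrier_mat n p" and d: "\<And>i. i < p \<Longrightarrow> cnj (d i) = - d i"
  shows "mat_adjoint (diag_congruence B d) = - diag_congruence B d"
proof -
  have "mat_diag p (\<lambda>i. cnj (d i)) = - mat_diag p d"
    using d by (intro eq_matI) (auto simp: mat_diag_def)
  then have "mat_adjoint (diag_congruence B d) = B * (- mat_diag p d) * mat_adjoint B"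
    unfolding diag_congruence_adjoint[OF B] using B by (simp add: diag_congruence_def)
  also have "\<dots> = - (B * mat_diag p d * mat_adjoint B)"
    using B by (simp add: mat_diag_def)
  finally show ?thesis using B by (simp add: diag_congruence_def)
qed

lemma diag_congruence_mult_vec:
  assumes B: "B \<in> carrier_mat n p" and v: "v \<in> carrier_vec n"
  shows "diag_congruence B d *\<^sub>v v = B *\<^sub>v (mat_diag p d *\<^sub>v (mat_adjoint B *\<^sub>v v))"
proof -
  have D: "mat_diag p d \<in> carrier_mat p p" by simp
  have adj: "mat_adjoint B \<in> carrier_mat p n" by (rule mat_adjoint_carrier[OF B])
  show ?thesis
    using B assoc_mult_mat_vec[OF mult_carrier_mat[OF B D] adj v]
      assoc_mult_mat_vec[OF B D mult_mat_vec_carrier[OF adj v]]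
    by (simp add: diag_congruence_def)
qed

text \<open>With \<open>y = B\<^sup>* v\<close> the quadratic form is \<open>\<Sum>\<^sub>i d\<^sub>i \<bar>y\<^sub>i\<bar>\<^sup>2\<close>.\<close>

lemma diag_congruence_form_nonneg:
  assumes B: "B \<in> carrier_mat n p" and d: "\<And>i. i < p \<Longrightarrow> 0 \<le> d i"
    and v: "v \<in> carrier_vec n"
  shows "0 \<le> (diag_congruence B d *\<^sub>v v) \<bullet>c v"
proof -
  define y where "y = mat_adjoint B *\<^sub>v v"
  have y: "y \<in> carrier_vec p" 
    unfolding y_def by (rule mult_mat_vec_carrier[OF mat_adjoint_carrier[OF B] v])
  have Dy: "mat_diag p d *\<^sub>v y \<in> carrier_vec p"
    by (rule mult_mat_vec_carrier[OF mat_diag_dim y])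
  have "(diag_congruence B d *\<^sub>v v) \<bullet>c v = (mat_diag p d *\<^sub>v y) \<bullet>c y"
    unfolding diag_congruence_mult_vec[OF B v]
    using cscalar_prod_adjoint[OF B Dy v] by (simp add: y_def)
  also have "\<dots> = (\<Sum>i<p. d i * (y $ i * cnj (y $ i)))"
    using y by (simp add: scalar_prod_def atLeast0LessThan mat_diag_mult_vec_index[OF y] mult.assoc
        del: index_mult_mat_vec)
  also have "0 \<le> \<dots>"
  proof (rule sum_nonneg)
    fix i assume i: "i \<in> {..<p}"
    have "0 \<le> y $ i * cnj (y $ i)" by (simp add: complex_mult_cnj less_eq_complex_def)
    moreover have "0 \<le> d i" using d i by simp
    ultimately show "0 \<le> d i * (y $ i * cnj (y $ i))" by (rule mult_nonneg_nonneg[rotated])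
  qed
  finally show ?thesis .
qed

lemma mult_unit_vec_col:
  fixes B :: "complex mat"
  assumes B: "B \<in> carrier_mat n p" and j: "j < p"
  shows "B *\<^sub>v unit_vec p j = col B j"
  using assms by (intro eq_vecI) auto

text \<open>A vector dual to the \<open>j\<close>-th column of \<open>B\<close> picks out the \<open>j\<close>-th term of
  \<open>B D B\<^sup>* = \<Sum>\<^sub>i d\<^sub>i b\<^sub>i b\<^sub>i\<^sup>*\<close>, where \<open>b\<^sub>i\<close> are the columns of \<open>B\<close>.\<close>

lemma diag_congruence_biorthogonal:
  assumes B: "B \<in> carrier_mat n p" and v: "v \<in> carrier_vec n" and j: "j < p"
    and adj: "mat_adjoint B *\<^sub>v v = unit_vec p j"
  shows "diag_congruence B d *\<^sub>v v = d j \<cdot>\<^sub>v col B j"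
proof -
  have "mat_diag p d *\<^sub>v unit_vec p j = d j \<cdot>\<^sub>v unit_vec p j"
    using j by (intro eq_vecI)
      (auto simp: mat_diag_mult_vec_index[of _ p] mat_diag_def)
  then show ?thesis unfolding diag_congruence_mult_vec[OF B v] adj
    using B j by (simp add: mult_mat_vec[of _ n p] mult_unit_vec_col)
qed

lemma diag_congruence_orthogonal:
  assumes B: "B \<in> carrier_mat n p" and v: "v \<in> carrier_vec n"
    and adj: "mat_adjoint B *\<^sub>v v = 0\<^sub>v p"
  shows "diag_congruence B d *\<^sub>v v = 0\<^sub>v n"
proof -
  have "mat_diag p d *\<^sub>v 0\<^sub>v p = 0\<^sub>v p" by (intro eq_vecI) (auto simp: mat_diag_def)
  then show ?thesis unfolding diag_congruence_mult_vec[OF B v] adj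
    using B by (intro eq_vecI) auto
qed


lemma adjoint_mult_vec_index:
  fixes B :: "complex mat"
  assumes "B \<in> carrier_mat n p" "v \<in> carrier_vec n" "i < p"
  shows "(mat_adjoint B *\<^sub>v v) $ i = v \<bullet>c col B i"
  using assms by (auto simp: scalar_prod_def mat_adjoint_index mult.commute intro!: sum.cong)

section \<open>Scalar computations\<close>

lemma one_minus_imaginary_square:
  assumes "Re a = 0"
  shows "1 - a * a = of_real (1 + (Im a)\<^sup>2)"
  using assms by (simp add: complex_eq_iff power2_eq_square)

lemma one_minus_imaginary_square_nonzero:
  assumes "Re a = 0"
  shows "1 - a * a \<noteq> 0"
proof -
  have "1 + (Im a)\<^sup>2 \<noteq> 0" using zero_le_power2[of "Im a"] by linarith
  then show ?thesis unfolding one_minus_imaginary_square[OF assms] of_real_eq_0_iff .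
qed

text \<open>The entries of the diagonal matrices in the middle of the two updates, for an old
  eigenvalue \<open>c\<close>, a new eigenvalue \<open>a\<close>, and the free parameters \<open>z\<close> (imaginary) and \<open>w\<close> (real).\<close>

definition update_M :: "complex \<Rightarrow> complex \<Rightarrow> complex \<Rightarrow> complex \<Rightarrow> complex" where
  "update_M c a z w = 1 / (1 - a * a) * (1 / c * (c - a) * a + z + w * a)"

definition update_K :: "complex \<Rightarrow> complex \<Rightarrow> complex \<Rightarrow> complex \<Rightarrow> complex" where
  "update_K c a z w = 1 / (1 - a * a) * (1 / c * (a - c) - z * a - w * (a * a))"

text \<open>In \<open>a m + k\<close> the free parameters cancel, and what is left of the brackets is
  \<open>(a - c) (1 - a\<^sup>2) / c\<close>; this is the reason for the factor \<open>1 / (1 - a\<^sup>2)\<close>.\<close>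

lemma update_moves_eigenvalue:
  assumes "c \<noteq> 0" "1 - a * a \<noteq> 0"
  shows "a * update_M c a z w + 1 + update_K c a z w = a / c"
proof -
  have distribute: "a * (h * (r * (c - a) * a + z + w * a)) + h * (r * (a - c) - z * a - w * (a * a))
      = h * ((1 - a * a) * (r * (a - c)))" for h r
    by (simp add: algebra_simps)
  have "a * update_M c a z w + update_K c a z w
      = 1 / (1 - a * a) * ((1 - a * a) * (1 / c * (a - c)))"
    unfolding update_M_def update_K_def by (rule distribute)
  also have "\<dots> = a / c - 1" using assms by (simp add: field_simps)
  finally show ?thesis by (simp add: algebra_simps)
qed

lemma update_M_imaginary:
  assumes "cnj c = - c" "cnj a = - a" "cnj z = - z" "cnj w = w"
  shows "cnj (update_M c a z w) = - update_M c a z w"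
  unfolding update_M_def by (simp add: assms) (simp add: algebra_simps diff_divide_distrib)

lemma update_K_real:
  assumes "cnj c = - c" "cnj a = - a" "cnj z = - z" "cnj w = w"
  shows "cnj (update_K c a z w) = update_K c a z w"
  unfolding update_K_def by (simp add: assms) (simp add: algebra_simps diff_divide_distrib)

lemma update_K_nonneg:
  assumes "Re a = 0" "0 \<le> 1 / c * (a - c) - z * a - w * (a * a)"
  shows "0 \<le> update_K c a z w"
proof -
  have "0 \<le> 1 / (1 - a * a)"
    unfolding one_minus_imaginary_square[OF assms(1)]
    by (simp add: less_eq_complex_def)
  then show ?thesis unfolding update_K_def using assms(2) by (rule mult_nonneg_nonneg)
qed

theorem mainTheorem9:
  fixes n p :: nat
    and M K :: "complex mat"
    and xc xf :: "nat \<Rightarrow> complex vec"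
    and lc lf :: "nat \<Rightarrow> complex"
    and Xc Xf Lc Lf La Z1 Z2 Ha Mhat Khat DM DK :: "complex mat"
  assumes p_le_n: "p \<le> n"
    and M: "M \<in> carrier_mat n n" "mat_adjoint M = - M"
    and K: "positive_definite n K"
    and basis: "basis_list n (map xc [0..<p] @ map xf [p..<n])"
    and eigen_c: "\<And>i. i < p \<Longrightarrow> pencil_eigenvector n M K (lc i) (xc i)"
    and eigen_f: "\<And>j. p \<le> j \<Longrightarrow> j < n \<Longrightarrow> pencil_eigenvector n M K (lf j) (xf j)"
    and lc_nonzero: "\<And>i. i < p \<Longrightarrow> lc i \<noteq> 0"
    and orthogonal: "\<And>i j. i < p \<Longrightarrow> j < p \<Longrightarrow> i \<noteq> j \<Longrightarrow> (K *\<^sub>v xc j) \<bullet>c xc i = 0"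
    and normalized: "\<And>i. i < p \<Longrightarrow> (K *\<^sub>v xc i) \<bullet>c xc i = 1"
    and Xc: "Xc = mat_of_cols n (map xc [0..<p])"
    and Xf: "Xf = mat_of_cols n (map xf [p..<n])"
    and Lc: "Lc = mat_diag p lc"
    and Lf: "Lf = mat_diag (n - p) (\<lambda>j. lf (p + j))"
    and disjoint: "lc ` {0..<p} \<inter> lf ` {p..<n} = {}"
    and La: "La \<in> carrier_mat p p" "diagonal_mat La" "\<And>i. i < p \<Longrightarrow> Re (La $$ (i, i)) = 0"
    and Z1: "Z1 \<in> carrier_mat p p" "diagonal_mat Z1" "\<And>i. i < p \<Longrightarrow> Re (Z1 $$ (i, i)) = 0"
    and Z2: "Z2 \<in> carrier_mat p p" "diagonal_mat Z2" "\<And>i. i < p \<Longrightarrow> Z2 $$ (i, i) \<in> \<real>"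
    and Ha: "Ha = mat_inv (1\<^sub>m p - La * La)"
    and Mhat: "Mhat = Ha * (mat_inv Lc * (Lc - La) * La + Z1 + Z2 * La)"
    and Khat: "Khat = Ha * (mat_inv Lc * (La - Lc) - Z1 * La - Z2 * (La * La))"
    and DM: "DM = K * Xc * Mhat * mat_adjoint Xc * K"
    and DK: "DK = K * Xc * Khat * mat_adjoint Xc * K"
  shows "mat_adjoint DM = - DM \<and> mat_adjoint DK = DK \<and>
    complementary_deflating_pairs n (M + DM) (K + DK) (Xc, La) (Xf, Lf) \<and>
    (diagonal_mat (mat_inv Lc * (La - Lc) - Z1 * La - Z2 * (La * La)) \<and>
       (\<forall>i < p. 0 \<le> (mat_inv Lc * (La - Lc) - Z1 * La - Z2 * (La * La)) $$ (i, i)) \<longrightarrow>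
     positive_semidefinite n DK \<and> positive_definite n (K + DK))"
proof -
  have Kc: "K \<in> carrier_mat n n" and Kh: "mat_adjoint K = K"
    using K unfolding positive_definite_def hermitian_mat_def by auto
  have xc: "xc i \<in> carrier_vec n" if "i < p" for i
    using eigen_c[OF that] unfolding pencil_eigenvector_def by simp
  have xf: "xf j \<in> carrier_vec n" if "p \<le> j" "j < n" for j
    using eigen_f[OF that] unfolding pencil_eigenvector_def by simp
  have Xf': "Xf = mat_of_cols n (map (\<lambda>j. xf (p + j)) [0..<n - p])"
  proof -
    have "map xf [p..<n] = map (\<lambda>j. xf (p + j)) [0..<n - p]"
      by (rule nth_equalityI) auto
    then show ?thesis unfolding Xf by simp
  qed
  have XcC: "Xc \<in> carrier_mat n p"
    using mat_of_cols_carrier(1)[of n "map xc [0..<p]"] unfolding Xc by simp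
  have colXc: "col Xc i = xc i" if "i < p" for i
    unfolding Xc using that xc by (subst col_mat_of_cols) auto

  define la where "la = (\<lambda>i. La $$ (i, i))"
  define z1 where "z1 = (\<lambda>i. Z1 $$ (i, i))"
  define z2 where "z2 = (\<lambda>i. Z2 $$ (i, i))"
  define m where "m = (\<lambda>i. update_M (lc i) (la i) (z1 i) (z2 i))"
  define k where "k = (\<lambda>i. update_K (lc i) (la i) (z1 i) (z2 i))"
  have La': "La = mat_diag p la" and Z1': "Z1 = mat_diag p z1" and Z2': "Z2 = mat_diag p z2"
    unfolding la_def z1_def z2_def
    by (rule diagonal_mat_eq_mat_diag[OF La(1,2)] diagonal_mat_eq_mat_diag[OF Z1(1,2)]
        diagonal_mat_eq_mat_diag[OF Z2(1,2)])+
  have im: "cnj (lc i) = - lc i" "cnj (la i) = - la i" "cnj (z1 i) = - z1 i" "cnj (z2 i) = z2 i"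
    if "i < p" for i
    using eigenvalue_imaginary[OF M K eigen_c[OF that]] La(3)[OF that] Z1(3)[OF that] Z2(3)[OF that]
    by (auto simp: la_def z1_def z2_def complex_eq_iff Reals_cnj_iff)
  have la_re: "Re (la i) = 0" if "i < p" for i using La(3)[OF that] by (simp add: la_def)
  have Lc_inv: "mat_inv (mat_diag p lc) = mat_diag p (\<lambda>i. 1 / lc i)"
    using lc_nonzero by (rule mat_inv_mat_diag)
  have "1\<^sub>m p - La * La = mat_diag p (\<lambda>i. 1 - la i * la i)"
    unfolding La' mat_diag_diag mat_diag_one[symmetric] mat_diag_diff ..
  then have Ha': "Ha = mat_diag p (\<lambda>i. 1 / (1 - la i * la i))"
    unfolding Ha
    by (simp only:) (rule mat_inv_mat_diag, rule one_minus_imaginary_square_nonzero[OF la_re])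
  have Mhat': "Mhat = mat_diag p m"
    unfolding Mhat Lc_inv Lc Ha' La' Z1' Z2' mat_diag_diag mat_diag_add mat_diag_diff
      m_def update_M_def ..
  have E: "mat_inv Lc * (La - Lc) - Z1 * La - Z2 * (La * La)
      = mat_diag p (\<lambda>i. 1 / lc i * (la i - lc i) - z1 i * la i - z2 i * (la i * la i))"
    unfolding Lc_inv Lc La' Z1' Z2' mat_diag_diag mat_diag_diff ..
  have Khat': "Khat = mat_diag p k"
    unfolding Khat E Ha' mat_diag_diag k_def update_K_def ..

  define B where "B = K * Xc"
  have B: "B \<in> carrier_mat n p" unfolding B_def by (rule mult_carrier_mat[OF Kc XcC])
  have colB: "col B i = K *\<^sub>v xc i" if "i < p" for i
    unfolding B_def using col_mult2[OF Kc XcC that] colXc[OF that] by simp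
  have adjB: "mat_adjoint B = mat_adjoint Xc * K"
    unfolding B_def mat_adjoint_mult[OF Kc XcC] Kh ..
  have cong: "K * Xc * mat_diag p d * mat_adjoint Xc * K = diag_congruence B d" for d
    unfolding diag_congruence_def carrier_matD(2)[OF B] adjB B_def[symmetric]
    by (rule assoc_mult_mat[OF mult_carrier_mat[OF B mat_diag_dim] mat_adjoint_carrier[OF XcC] Kc])
  have DM': "DM = diag_congruence B m" and DK': "DK = diag_congruence B k"
    unfolding DM DK Mhat' Khat' cong by (rule refl)+
  have DMc: "DM \<in> carrier_mat n n" and DKc: "DK \<in> carrier_mat n n"
    unfolding DM' DK' by (rule diag_congruence_carrier[OF B])+

  have adj_index: "(mat_adjoint B *\<^sub>v v) $ i = (K *\<^sub>v v) \<bullet>c xc i"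
    if "v \<in> carrier_vec n" "i < p" for v i
    using adjoint_mult_vec_index[OF B that] colB[OF that(2)]
      cscalar_prod_adjoint[OF Kc that(1) xc[OF that(2)]] Kh by simp
  have adj_xc: "mat_adjoint B *\<^sub>v xc j = unit_vec p j" if j: "j < p" for j
  proof (rule eq_vecI)
    fix i assume "i < dim_vec (unit_vec p j :: complex vec)"
    then have i: "i < p" by simp
    show "(mat_adjoint B *\<^sub>v xc j) $ i = unit_vec p j $ i"
      unfolding adj_index[OF xc[OF j] i]
      using orthogonal[OF i j] normalized[OF i] i j by (cases "i = j") auto
  qed (use B in auto)
  have adj_xf: "mat_adjoint B *\<^sub>v xf j = 0\<^sub>v p" if j: "p \<le> j" "j < n" for j
  proof (rule eq_vecI)
    fix i assume "i < dim_vec (0\<^sub>v p :: complex vec)"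
    then have i: "i < p" by simp
    have "lf j \<noteq> lc i" using disjoint i j by force
    then show "(mat_adjoint B *\<^sub>v xf j) $ i = 0\<^sub>v p $ i"
      unfolding adj_index[OF xf[OF j] i]
      using eigenvectors_orthogonal[OF M K eigen_f[OF j] eigen_c[OF i]] i by simp
  qed (use B in auto)

  have ev_c: "pencil (M + DM) (K + DK) (la j) *\<^sub>v xc j = 0\<^sub>v n" if j: "j < p" for j
  proof (rule eq_vecI)
    fix i assume "i < dim_vec (0\<^sub>v n :: complex vec)"
    then have i: "i < n" by simp
    define u where "u = (M *\<^sub>v xc j) $ i"
    define v where "v = (K *\<^sub>v xc j) $ i"
    have "(lc j \<cdot>\<^sub>v (M *\<^sub>v xc j) + K *\<^sub>v xc j) $ i = 0"
      using eigen_c[OF j] pencil_mult_vec[OF M(1) Kc xc[OF j]] i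
      unfolding pencil_eigenvector_def by simp
    then have "lc j * u + v = 0"
      using i M(1) Kc unfolding u_def v_def by (simp del: index_mult_mat_vec)
    then have v: "v = - lc j * u" by (simp add: add_eq_0_iff)
    have "(DM *\<^sub>v xc j) $ i = m j * v" "(DK *\<^sub>v xc j) $ i = k j * v"
      unfolding DM' DK' diag_congruence_biorthogonal[OF B xc[OF j] j adj_xc[OF j]] colB[OF j] v_def
      using i Kc by (simp_all del: index_mult_mat_vec)
    then have "(pencil (M + DM) (K + DK) (la j) *\<^sub>v xc j) $ i = la j * (u + m j * v) + (v + k j * v)"
      unfolding pencil_mult_vec[OF add_carrier_mat[OF DMc] add_carrier_mat[OF DKc] xc[OF j]]
        add_mult_distrib_mat_vec[OF M(1) DMc xc[OF j]] add_mult_distrib_mat_vec[OF Kc DKc xc[OF j]]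
      using i M(1) Kc DMc DKc unfolding u_def v_def by (simp del: index_mult_mat_vec)
    also have "\<dots> = la j * u + (la j * m j + 1 + k j) * v" by (simp add: algebra_simps)
    also have "\<dots> = la j * u + la j / lc j * v"
      unfolding m_def k_def
      by (simp only: update_moves_eigenvalue[OF lc_nonzero[OF j]
            one_minus_imaginary_square_nonzero[OF la_re[OF j]]])
    also have "\<dots> = 0" unfolding v using lc_nonzero[OF j] by simp
    finally show "(pencil (M + DM) (K + DK) (la j) *\<^sub>v xc j) $ i = 0\<^sub>v n $ i" using i by simp
  qed (use DKc in \<open>simp add: pencil_def\<close>)

  have ev_f: "pencil (M + DM) (K + DK) (lf j) *\<^sub>v xf j = 0\<^sub>v n" if j: "p \<le> j" "j < n" for j
  proof -
    have z: "DM *\<^sub>v xf j = 0\<^sub>v n" "DK *\<^sub>v xf j = 0\<^sub>v n"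
      unfolding DM' DK' by (rule diag_congruence_orthogonal[OF B xf[OF j] adj_xf[OF j]])+
    have "M *\<^sub>v xf j + 0\<^sub>v n = M *\<^sub>v xf j" "K *\<^sub>v xf j + 0\<^sub>v n = K *\<^sub>v xf j"
      by (rule right_zero_vec, rule mult_mat_vec_carrier[OF M(1) xf[OF j]])
        (rule right_zero_vec, rule mult_mat_vec_carrier[OF Kc xf[OF j]])
    then show ?thesis
      using eigen_f[OF j] pencil_mult_vec[OF M(1) Kc xf[OF j], of "lf j"]
      unfolding pencil_mult_vec[OF add_carrier_mat[OF DMc] add_carrier_mat[OF DKc] xf[OF j]]
        add_mult_distrib_mat_vec[OF M(1) DMc xf[OF j]] add_mult_distrib_mat_vec[OF Kc DKc xf[OF j]]
        z pencil_eigenvector_def by simp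
  qed

  have dist: "distinct (map xc [0..<p] @ map xf [p..<n])" using basis unfolding basis_list_def by simp
  have "vec_space.rank n Xc = p"
    unfolding Xc using basis_list_rank[OF basis, of "map xc [0..<p]"] dist by simp
  then have defl_c: "deflating_pair n p (M + DM) (K + DK) (Xc, La)"
    unfolding La' using ev_c xc p_le_n unfolding Xc
    by (intro deflating_pair_diagI[OF add_carrier_mat[OF DMc] add_carrier_mat[OF DKc]]) auto
  have "vec_space.rank n Xf = n - p"
    unfolding Xf using basis_list_rank[OF basis, of "map xf [p..<n]"] dist by simp
  then have defl_f: "deflating_pair n (n - p) (M + DM) (K + DK) (Xf, Lf)"
    unfolding Lf using ev_f xf unfolding Xf'
    by (intro deflating_pair_diagI[OF add_carrier_mat[OF DMc] add_carrier_mat[OF DKc]]) auto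
  have "cols Xc = map xc [0..<p]" "cols Xf = map xf [p..<n]"
    unfolding Xc Xf using xc xf by (auto intro!: cols_mat_of_cols)
  then have "invertible_mat (mat_of_cols n (cols Xc @ cols Xf))"
    using basis_list_invertible[OF basis] p_le_n by simp
  moreover have "dim_col Xc = p" "dim_col Xf = n - p" unfolding Xc Xf by simp_all
  ultimately have compl: "complementary_deflating_pairs n (M + DM) (K + DK) (Xc, La) (Xf, Lf)"
    unfolding complementary_deflating_pairs_def using defl_c defl_f by simp

  have DM_skew: "mat_adjoint DM = - DM"
    unfolding DM' m_def using im by (intro diag_congruence_skew[OF B] update_M_imaginary)
  have DK_herm: "mat_adjoint DK = DK"
    unfolding DK' k_def using im by (intro diag_congruence_hermitian[OF B] update_K_real)

  have "positive_semidefinite n DK \<and> positive_definite n (K + DK)"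
    if nonneg: "\<forall>i < p. 0 \<le> (mat_inv Lc * (La - Lc) - Z1 * La - Z2 * (La * La)) $$ (i, i)"
  proof
    have "0 \<le> k i" if "i < p" for i
      unfolding k_def using nonneg that unfolding E
      by (intro update_K_nonneg[OF la_re]) (auto simp: mat_diag_def)
    then have form: "0 \<le> (DK *\<^sub>v v) \<bullet>c v" if "v \<in> carrier_vec n" for v
      unfolding DK' using that by (intro diag_congruence_form_nonneg[OF B])
    then show "positive_semidefinite n DK"
      unfolding positive_semidefinite_def hermitian_mat_def using DKc DK_herm by blast
    have "0 < ((K + DK) *\<^sub>v v) \<bullet>c v" if v: "v \<in> carrier_vec n" "v \<noteq> 0\<^sub>v n" for v
    proof -
      have "((K + DK) *\<^sub>v v) \<bullet>c v = (K *\<^sub>v v) \<bullet>c v + (DK *\<^sub>v v) \<bullet>c v"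
        unfolding add_mult_distrib_mat_vec[OF Kc DKc v(1)]
        by (rule add_scalar_prod_distrib[OF mult_mat_vec_carrier[OF Kc v(1)]
              mult_mat_vec_carrier[OF DKc v(1)] carrier_vec_conjugate[OF v(1)]])
      moreover have "0 < (K *\<^sub>v v) \<bullet>c v" using K v unfolding positive_definite_def by blast
      ultimately show ?thesis using form[OF v(1)] by (simp add: add_pos_nonneg)
    qed
    then show "positive_definite n (K + DK)"
      unfolding positive_definite_def hermitian_mat_def mat_adjoint_add[OF Kc DKc] Kh DK_herm
      using add_carrier_mat[OF DKc] by blast
  qed
  then show ?thesis using DM_skew DK_herm compl by blast
qed

end
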